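(* Let $k$ be a field of characteristic different from $2$, let $kZ_2$ be the group bialgebra generated by $t$ with $t^2=1$, $\Delta(t)=t\otimes t$, $\varepsilon(t)=1$, regarded as a left bialgebroid $\mathcal A_L=(kZ_2,k,\eta,\eta,\Delta,\varepsilon)$ over the base $k$, where $\eta:k\to kZ_2$, $\lambda\mapsto\lambda1$. Let $S:kZ_2\to kZ_2$ be the $k$-algebra (anti-)automorphism with $S(t)=-t$. Then $(\mathcal A_L,S)$ is a Hopf algebroid (in the sense of the definition in the context) but it is not a Hopf algebroid in the sense of J.-H. Lu.
   Context: A left bialgebroid $\mathcal A_L=(A,L,s_L,t_L,\gamma_L,\pi_L)$ consists of rings $A$, $L$, ring homomorphisms $s_L:L\to A$, $t_L:L^{op}\to A$ with commuting images, and a comonoid structure $\gamma_L:A\to A\otimes_LA$, $\gamma_L(a)=a_{(1)}\otimes a_{(2)}$, $\pi_L:A\to L$ on the $L$-$L$-bimodule $A$ with $l\cdot a\cdot l'=s_L(l)t_L(l')a$, satisfying $a_{(1)}t_L(l)\otimes a_{(2)}=a_{(1)}\otimes a_{(2)}s_L(l)$, $\gamma_L(1)=1\otimes1$, $\gamma_L(ab)=\gamma_L(a)\gamma_L(b)$, $\pi_L(1)=1$, $\pi_L(as_L(\pi_L(b)))=\pi_L(ab)=\pi_L(at_L(\pi_L(b)))$. A bialgebra over a field $k$ is a left bialgebroid with $L=k$ and $s_L=t_L=$ the unit map. A Hopf algebroid is a pair $(\mathcal A_L,S)$ with $S$ an anti-automorphism of the ring $A$ such that $S\circ t_L=s_L$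 and, for all $a\in A$, in $A\otimes_LA$: $S^{-1}(a_{(2)})_{(1')}\otimes S^{-1}(a_{(2)})_{(2')}a_{(1)}=S^{-1}(a)\otimes1$ and $S(a_{(1)})_{(1')}a_{(2)}\otimes S(a_{(1)})_{(2')}=1\otimes S(a)$, where primed indices denote a further application of $\gamma_L$. A Hopf algebroid in the sense of Lu (for $A$, $L$ algebras over a commutative ring $k$) is a pair $(\mathcal A_L,S)$ with $S$ an anti-automorphism of the algebra $A$ such that: $S\circ t_L=s_L$; $S(a_{(1)})a_{(2)}=t_L\circ\pi_L\circ S(a)$ for all $a$; and there is a linear section $\zeta:A\otimes_LA\to A\otimes_kA$ of the canonical projection $A\otimes_kA\to A\otimes_LA$ with $m_A\circ(\mathrm{id}_A\otimes S)\circ\zeta\circ\gamma_L=s_L\circ\pi_L$, where $m_A$ is the multiplication. *)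

theory Defs
  imports
    "HOL-Library.Poly_Mapping"
    "HOL-Library.Z2"
    "HOL-Computational_Algebra.Computational_Algebra"
begin

section \<open>Tensor products over a possibly noncommutative ring\<close>

text \<open>
  \<open>M \<otimes>\<^sub>L N\<close> is the free abelian group on \<open>M \<times> N\<close> modulo the subgroup generated by the
  biadditivity and balancing relations. The right action on \<open>M\<close> and the left action on \<open>N\<close> are
  explicit parameters because one type carries several actions here. Elements of
  \<open>M \<otimes>\<^sub>L N\<close> are the cosets of this subgroup.
\<close>

inductive_set tensor_null ::
  "('m::ab_group_add \<Rightarrow> 'l \<Rightarrow> 'm) \<Rightarrow> ('l \<Rightarrow> 'n::ab_group_add \<Rightarrow> 'n) \<Rightarrow> ('m \<times> 'n \<Rightarrow>\<^sub>0 int) set"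
  for ract lact where
  zero: "0 \<in> tensor_null ract lact"
| diff: "c \<in> tensor_null ract lact \<Longrightarrow> c' \<in> tensor_null ract lact \<Longrightarrow> c - c' \<in> tensor_null ract lact"
| add_left: "frag_of (x + x', y) - frag_of (x, y) - frag_of (x', y) \<in> tensor_null ract lact"
| add_right: "frag_of (x, y + y') - frag_of (x, y) - frag_of (x, y') \<in> tensor_null ract lact"
| balanced: "frag_of (ract x l, y) - frag_of (x, lact l y) \<in> tensor_null ract lact"

definition tensor_class ::
  "('m::ab_group_add \<Rightarrow> 'l \<Rightarrow> 'm) \<Rightarrow> ('l \<Rightarrow> 'n::ab_group_add \<Rightarrow> 'n)
     \<Rightarrow> ('m \<times> 'n \<Rightarrow>\<^sub>0 int) \<Rightarrow> ('m \<times> 'n \<Rightarrow>\<^sub>0 int) set" where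
  "tensor_class ract lact c = {c'. c' - c \<in> tensor_null ract lact}"

definition tensor_product ::
  "('m::ab_group_add \<Rightarrow> 'l \<Rightarrow> 'm) \<Rightarrow> ('l \<Rightarrow> 'n::ab_group_add \<Rightarrow> 'n) \<Rightarrow> ('m \<times> 'n \<Rightarrow>\<^sub>0 int) set set" where
  "tensor_product ract lact = range (tensor_class ract lact)"

text \<open>The list \<open>[(x\<^sub>1, y\<^sub>1), \<dots>, (x\<^sub>n, y\<^sub>n)]\<close> stands for \<open>x\<^sub>1 \<otimes> y\<^sub>1 + \<dots> + x\<^sub>n \<otimes> y\<^sub>n\<close>.\<close>

definition tensor_sum ::
  "('m::ab_group_add \<Rightarrow> 'l \<Rightarrow> 'm) \<Rightarrow> ('l \<Rightarrow> 'n::ab_group_add \<Rightarrow> 'n)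
     \<Rightarrow> ('m \<times> 'n) list \<Rightarrow> ('m \<times> 'n \<Rightarrow>\<^sub>0 int) set" where
  "tensor_sum ract lact xs = tensor_class ract lact (\<Sum>p\<leftarrow>xs. frag_of p)"

inductive_set tensor3_null ::
  "('m::ab_group_add \<Rightarrow> 'l \<Rightarrow> 'm) \<Rightarrow> ('l \<Rightarrow> 'm \<Rightarrow> 'm) \<Rightarrow> ('m \<times> 'm \<times> 'm \<Rightarrow>\<^sub>0 int) set"
  for ract lact where
  zero: "0 \<in> tensor3_null ract lact"
| diff: "c \<in> tensor3_null ract lact \<Longrightarrow> c' \<in> tensor3_null ract lact \<Longrightarrow> c - c' \<in> tensor3_null ract lact"
| add1: "frag_of (x + x', y, z) - frag_of (x, y, z) - frag_of (x', y, z) \<in> tensor3_null ract lact"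
| add2: "frag_of (x, y + y', z) - frag_of (x, y, z) - frag_of (x, y', z) \<in> tensor3_null ract lact"
| add3: "frag_of (x, y, z + z') - frag_of (x, y, z) - frag_of (x, y, z') \<in> tensor3_null ract lact"
| balanced12: "frag_of (ract x l, y, z) - frag_of (x, lact l y, z) \<in> tensor3_null ract lact"
| balanced23: "frag_of (x, ract y l, z) - frag_of (x, y, lact l z) \<in> tensor3_null ract lact"

definition tensor3_sum ::
  "('m::ab_group_add \<Rightarrow> 'l \<Rightarrow> 'm) \<Rightarrow> ('l \<Rightarrow> 'm \<Rightarrow> 'm)
     \<Rightarrow> ('m \<times> 'm \<times> 'm) list \<Rightarrow> ('m \<times> 'm \<times> 'm \<Rightarrow>\<^sub>0 int) set" where
  "tensor3_sum ract lact xs = {c. c - (\<Sum>p\<leftarrow>xs. frag_of p) \<in> tensor3_null ract lact}"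


section \<open>Left bialgebroids\<close>

text \<open>
  The bimodule structure is \<open>l \<cdot> a \<cdot> l' = s(l) t(l') a\<close>, so that \<open>t(l) a \<otimes> b = a \<otimes> s(l) b\<close>
  in \<open>A \<otimes>\<^sub>L A\<close>.
\<close>

abbreviation (input) bgd_ract :: "('l \<Rightarrow> 'a::{ring, monoid_mult}) \<Rightarrow> 'a \<Rightarrow> 'l \<Rightarrow> 'a" where
  "bgd_ract t \<equiv> \<lambda>a l. t l * a"

abbreviation (input) bgd_lact :: "('l \<Rightarrow> 'a::{ring, monoid_mult}) \<Rightarrow> 'l \<Rightarrow> 'a \<Rightarrow> 'a" where
  "bgd_lact s \<equiv> \<lambda>l a. s l * a"

abbreviation tens ::
  "('l \<Rightarrow> 'a::{ring, monoid_mult}) \<Rightarrow> ('l \<Rightarrow> 'a) \<Rightarrow> ('a \<times> 'a) list \<Rightarrow> ('a \<times> 'a \<Rightarrow>\<^sub>0 int) set" where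
  "tens s t \<equiv> tensor_sum (bgd_ract t) (bgd_lact s)"

abbreviation tens3 ::
  "('l \<Rightarrow> 'a::{ring, monoid_mult}) \<Rightarrow> ('l \<Rightarrow> 'a) \<Rightarrow> ('a \<times> 'a \<times> 'a) list \<Rightarrow> ('a \<times> 'a \<times> 'a \<Rightarrow>\<^sub>0 int) set"
  where
  "tens3 s t \<equiv> tensor3_sum (bgd_ract t) (bgd_lact s)"

text \<open>
  Sweedler notation: \<open>d\<close> chooses, for every \<open>a\<close>, a list of pairs whose sum of tensors is
  \<open>\<gamma>(a)\<close>; then \<open>a\<^sub>(\<^sub>1\<^sub>) \<otimes> a\<^sub>(\<^sub>2\<^sub>)\<close> is the sum over \<open>d a\<close>. The axioms below are required for every
  such choice.
\<close>

definition sweedler ::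
  "('l \<Rightarrow> 'a::{ring, monoid_mult}) \<Rightarrow> ('l \<Rightarrow> 'a) \<Rightarrow> ('a \<Rightarrow> ('a \<times> 'a \<Rightarrow>\<^sub>0 int) set)
     \<Rightarrow> ('a \<Rightarrow> ('a \<times> 'a) list) \<Rightarrow> bool" where
  "sweedler s t \<gamma> d \<longleftrightarrow> (\<forall>a. tens s t (d a) = \<gamma> a)"

text \<open>The sort \<open>{ring, monoid_mult}\<close> is that of unital rings, the zero ring included.\<close>

locale left_bialgebroid =
  fixes s :: "'l::{ring, monoid_mult} \<Rightarrow> 'a::{ring, monoid_mult}"
    and t :: "'l \<Rightarrow> 'a"
    and \<gamma> :: "'a \<Rightarrow> ('a \<times> 'a \<Rightarrow>\<^sub>0 int) set"
    and \<pi> :: "'a \<Rightarrow> 'l"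
  assumes s_add: "s (l + l') = s l + s l'"
    and s_mult: "s (l * l') = s l * s l'"
    and s_one: "s 1 = 1"
    and t_add: "t (l + l') = t l + t l'"
    and t_mult: "t (l * l') = t l' * t l"
    and t_one: "t 1 = 1"
    and s_t_commute: "s l * t l' = t l' * s l"
  \<comment> \<open>\<open>\<gamma>\<close> and \<open>\<pi>\<close> are bimodule maps\<close>
    and comult_in: "\<gamma> a \<in> tensor_product (bgd_ract t) (bgd_lact s)"
    and comult_add: "sweedler s t \<gamma> d \<Longrightarrow> \<gamma> (a + b) = tens s t (d a @ d b)"
    and comult_bimodule:
      "sweedler s t \<gamma> d \<Longrightarrow> \<gamma> (s l * t l' * a) = tens s t [(s l * x, t l' * y). (x, y) \<leftarrow> d a]"
    and counit_add: "\<pi> (a + b) = \<pi> a + \<pi> b"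
    and counit_bimodule: "\<pi> (s l * t l' * a) = l * \<pi> a * l'"
  \<comment> \<open>comonoid\<close>
    and coassoc:
      "sweedler s t \<gamma> d \<Longrightarrow>
         tens3 s t [(u, v, y). (x, y) \<leftarrow> d a, (u, v) \<leftarrow> d x] =
         tens3 s t [(x, u, v). (x, y) \<leftarrow> d a, (u, v) \<leftarrow> d y]"
    and counit_left: "sweedler s t \<gamma> d \<Longrightarrow> (\<Sum>(x, y)\<leftarrow>d a. s (\<pi> x) * y) = a"
    and counit_right: "sweedler s t \<gamma> d \<Longrightarrow> (\<Sum>(x, y)\<leftarrow>d a. t (\<pi> y) * x) = a"
  \<comment> \<open>compatibility with the ring structure; the first condition makes the product of
      \<open>\<gamma>(a)\<close> and \<open>\<gamma>(b)\<close> independent of representatives\<close>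
    and takeuchi:
      "sweedler s t \<gamma> d \<Longrightarrow>
         tens s t [(x * t l, y). (x, y) \<leftarrow> d a] = tens s t [(x, y * s l). (x, y) \<leftarrow> d a]"
    and comult_one: "\<gamma> 1 = tens s t [(1, 1)]"
    and comult_mult:
      "sweedler s t \<gamma> d \<Longrightarrow>
         \<gamma> (a * b) = tens s t [(x * u, y * v). (x, y) \<leftarrow> d a, (u, v) \<leftarrow> d b]"
    and counit_one: "\<pi> 1 = 1"
    and counit_mult_s: "\<pi> (a * s (\<pi> b)) = \<pi> (a * b)"
    and counit_mult_t: "\<pi> (a * t (\<pi> b)) = \<pi> (a * b)"


section \<open>Hopf algebroids\<close>

definition ring_anti_automorphism :: "('a::{ring, monoid_mult} \<Rightarrow> 'a) \<Rightarrow> bool" where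
  "ring_anti_automorphism S \<longleftrightarrow>
     bij S \<and> (\<forall>a b. S (a + b) = S a + S b) \<and> (\<forall>a b. S (a * b) = S b * S a) \<and> S 1 = 1"

locale hopf_algebroid = left_bialgebroid s t \<gamma> \<pi>
  for s :: "'l::{ring, monoid_mult} \<Rightarrow> 'a::{ring, monoid_mult}" and t \<gamma> \<pi> +
  fixes S :: "'a \<Rightarrow> 'a"
  assumes S_anti: "ring_anti_automorphism S"
    and S_t: "S (t l) = s l"
    and S_inv_axiom:
      "sweedler s t \<gamma> d \<Longrightarrow>
         tens s t [(u, v * x). (x, y) \<leftarrow> d a, (u, v) \<leftarrow> d (inv S y)] = tens s t [(inv S a, 1)]"
    and S_axiom:
      "sweedler s t \<gamma> d \<Longrightarrow>
         tens s t [(u * y, v). (x, y) \<leftarrow> d a, (u, v) \<leftarrow> d (S x)] = tens s t [(1, S a)]"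


section \<open>Hopf algebroids in the sense of Lu\<close>

locale k_algebra = module scale
  for scale :: "'k::comm_ring_1 \<Rightarrow> 'a::{ring, monoid_mult} \<Rightarrow> 'a" +
  assumes scale_mult_left: "scale c a * b = scale c (a * b)"
    and scale_mult_right: "a * scale c b = scale c (a * b)"

abbreviation tens_k ::
  "('k::comm_ring_1 \<Rightarrow> 'a::{ring, monoid_mult} \<Rightarrow> 'a) \<Rightarrow> ('a \<times> 'a) list \<Rightarrow> ('a \<times> 'a \<Rightarrow>\<^sub>0 int) set" where
  "tens_k scale \<equiv> tensor_sum (\<lambda>a c. scale c a) scale"

text \<open>
  A \<open>k\<close>-linear section of the canonical projection \<open>A \<otimes>\<^sub>k A \<rightarrow> A \<otimes>\<^sub>L A\<close>, which sends
  \<open>tens_k scale us\<close> to \<open>tens s t us\<close>. Concatenation of lists is addition of tensors.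
\<close>

definition linear_section ::
  "('k::comm_ring_1 \<Rightarrow> 'a::{ring, monoid_mult} \<Rightarrow> 'a) \<Rightarrow> ('l \<Rightarrow> 'a) \<Rightarrow> ('l \<Rightarrow> 'a)
     \<Rightarrow> (('a \<times> 'a \<Rightarrow>\<^sub>0 int) set \<Rightarrow> ('a \<times> 'a \<Rightarrow>\<^sub>0 int) set) \<Rightarrow> bool" where
  "linear_section scale s t \<zeta> \<longleftrightarrow>
     (\<forall>T \<in> tensor_product (bgd_ract t) (bgd_lact s). \<zeta> T \<in> tensor_product (\<lambda>a c. scale c a) scale) \<and>
     (\<forall>xs ys us vs. \<zeta> (tens s t xs) = tens_k scale us \<longrightarrow> \<zeta> (tens s t ys) = tens_k scale vs \<longrightarrow>
        \<zeta> (tens s t (xs @ ys)) = tens_k scale (us @ vs)) \<and>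
     (\<forall>c xs us. \<zeta> (tens s t xs) = tens_k scale us \<longrightarrow>
        \<zeta> (tens s t [(scale c x, y). (x, y) \<leftarrow> xs]) = tens_k scale [(scale c x, y). (x, y) \<leftarrow> us]) \<and>
     (\<forall>xs us. \<zeta> (tens s t xs) = tens_k scale us \<longrightarrow> tens s t us = tens s t xs)"

locale lu_hopf_algebroid =
  left_bialgebroid s t \<gamma> \<pi> + A: k_algebra scaleA + L: k_algebra scaleL
  for scaleA :: "'k::comm_ring_1 \<Rightarrow> 'a::{ring, monoid_mult} \<Rightarrow> 'a"
    and scaleL :: "'k \<Rightarrow> 'l::{ring, monoid_mult} \<Rightarrow> 'l"
    and s :: "'l \<Rightarrow> 'a" and t \<gamma> \<pi> +
  fixes S :: "'a \<Rightarrow> 'a"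
  assumes s_scale: "s (scaleL c l) = scaleA c (s l)"
    and t_scale: "t (scaleL c l) = scaleA c (t l)"
    and S_anti: "ring_anti_automorphism S"
    and S_scale: "S (scaleA c a) = scaleA c (S a)"
    and S_t: "S (t l) = s l"
    and S_left: "sweedler s t \<gamma> d \<Longrightarrow> (\<Sum>(x, y)\<leftarrow>d a. S x * y) = t (\<pi> (S a))"
    and S_right:
      "\<exists>\<zeta>. linear_section scaleA s t \<zeta> \<and>
         (\<forall>a us. \<zeta> (\<gamma> a) = tens_k scaleA us \<longrightarrow> (\<Sum>(x, y)\<leftarrow>us. x * S y) = s (\<pi> a))"


section \<open>Group bialgebras and the twisted antipode on \<open>kZ\<^sub>2\<close>\<close>

text \<open>
  For an additively written group \<open>'g\<close>, the convolution ring \<open>'g \<Rightarrow>\<^sub>0 'k\<close> is the group algebra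
  of \<open>'g\<close> over \<open>'k\<close>, with \<open>Poly_Mapping.single g 1\<close> the basis element of \<open>g\<close>. The group
  \<open>Z\<^sub>2\<close> is the additive group of the type \<open>bit\<close>.
\<close>

abbreviation ga_scale :: "'k::field \<Rightarrow> ('g::group_add \<Rightarrow>\<^sub>0 'k) \<Rightarrow> ('g \<Rightarrow>\<^sub>0 'k)" where
  "ga_scale c \<equiv> Poly_Mapping.map ((*) c)"

definition ga_unit :: "'k::field \<Rightarrow> ('g::group_add \<Rightarrow>\<^sub>0 'k)" where
  "ga_unit c = ga_scale c 1"

text \<open>The linear maps with \<open>\<Delta>(g) = g \<otimes> g\<close> and \<open>\<epsilon>(g) = 1\<close> for every group element \<open>g\<close>.\<close>

definition ga_comult ::
  "('g::group_add \<Rightarrow>\<^sub>0 'k::field) \<Rightarrow> (('g \<Rightarrow>\<^sub>0 'k) \<times> ('g \<Rightarrow>\<^sub>0 'k) \<Rightarrow>\<^sub>0 int) set" where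
  "ga_comult p = tensor_class (\<lambda>a c. ga_scale c a) ga_scale
     (\<Sum>g\<in>Poly_Mapping.keys p.
        frag_of (Poly_Mapping.single g (Poly_Mapping.lookup p g), Poly_Mapping.single g 1))"

definition ga_counit :: "('g::group_add \<Rightarrow>\<^sub>0 'k::field) \<Rightarrow> 'k" where
  "ga_counit p = (\<Sum>g\<in>Poly_Mapping.keys p. Poly_Mapping.lookup p g)"

definition gen_t :: "bit \<Rightarrow>\<^sub>0 'k::field" where
  "gen_t = Poly_Mapping.single 1 1"

definition twisted_S :: "(bit \<Rightarrow>\<^sub>0 'k::field) \<Rightarrow> (bit \<Rightarrow>\<^sub>0 'k)" where
  "twisted_S p = ga_scale (Poly_Mapping.lookup p 0) 1 - ga_scale (Poly_Mapping.lookup p 1) gen_t"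


section \<open>Sanity checks\<close>

lemma tensor_null_uminus: "c \<in> tensor_null r l \<Longrightarrow> - c \<in> tensor_null r l"
  using tensor_null.diff[OF tensor_null.zero] by fastforce

lemma tensor_null_add:
  assumes "c \<in> tensor_null r l" "c' \<in> tensor_null r l"
  shows "c + c' \<in> tensor_null r l"
  using tensor_null.diff[OF assms(1) tensor_null_uminus[OF assms(2)]] by simp

lemma tensor_class_eq_iff:
  "tensor_class r l c = tensor_class r l c' \<longleftrightarrow> c - c' \<in> tensor_null r l"
proof
  assume "tensor_class r l c = tensor_class r l c'"
  moreover have "c \<in> tensor_class r l c"
    by (simp add: tensor_class_def tensor_null.zero)
  ultimately show "c - c' \<in> tensor_null r l"
    by (auto simp: tensor_class_def)
next
  assume *: "c - c' \<in> tensor_null r l"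
  have "x - c \<in> tensor_null r l \<longleftrightarrow> x - c' \<in> tensor_null r l" for x
    using tensor_null_add[OF _ *, of "x - c"] tensor_null.diff[OF _ *, of "x - c'"]
    by auto
  then show "tensor_class r l c = tensor_class r l c'"
    by (auto simp: tensor_class_def)
qed

text \<open>Every tensor is a finite sum of pure tensors, hence a \<open>sweedler\<close> choice always exists.\<close>

lemma tensor_product_eq_range_tensor_sum: "tensor_product r l = range (tensor_sum r l)"
proof -
  have "\<exists>xs. c - (\<Sum>p\<leftarrow>xs. frag_of p) \<in> tensor_null r l" for c
  proof (rule frag_induction[of c UNIV "\<lambda>c. \<exists>xs. c - (\<Sum>p\<leftarrow>xs. frag_of p) \<in> tensor_null r l"])
    show "Poly_Mapping.keys c \<subseteq> UNIV" by simp
  next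
    have "0 - (\<Sum>p\<leftarrow>[]. frag_of p) \<in> tensor_null r l" by (simp add: tensor_null.zero)
    then show "\<exists>xs. 0 - (\<Sum>p\<leftarrow>xs. frag_of p) \<in> tensor_null r l" by blast
  next
    fix p
    have "frag_of p - (\<Sum>p\<leftarrow>[p]. frag_of p) \<in> tensor_null r l" by (simp add: tensor_null.zero)
    then show "\<exists>xs. frag_of p - (\<Sum>p\<leftarrow>xs. frag_of p) \<in> tensor_null r l" by blast
  next
    fix a b
    assume "\<exists>xs. a - (\<Sum>p\<leftarrow>xs. frag_of p) \<in> tensor_null r l"
      and "\<exists>xs. b - (\<Sum>p\<leftarrow>xs. frag_of p) \<in> tensor_null r l"
    then obtain xs ys where xs: "a - (\<Sum>p\<leftarrow>xs. frag_of p) \<in> tensor_null r l"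
      and ys: "b - (\<Sum>p\<leftarrow>ys. frag_of p) \<in> tensor_null r l" by blast
    define ys' where "ys' = map (\<lambda>(x, y). (- x, y)) ys"
    have zero_left: "frag_of (0, y) \<in> tensor_null r l" for y
      using tensor_null_uminus[OF tensor_null.add_left[of 0 0 y r l]] by simp
    have neg: "frag_of (- x, y) + frag_of (x, y) \<in> tensor_null r l" for x y
      using tensor_null.diff[OF zero_left[of y] tensor_null.add_left[of "- x" x y r l]]
      by (simp add: algebra_simps)
    have "(\<Sum>p\<leftarrow>ys'. frag_of p) + (\<Sum>p\<leftarrow>ys. frag_of p) \<in> tensor_null r l"
      unfolding ys'_def
    proof (induction ys)
      case Nil
      then show ?case by (simp add: tensor_null.zero)
    next
      case (Cons p ps)
      then show ?case
        using tensor_null_add[OF neg[of "fst p" "snd p"] Cons.IH]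
        by (simp add: case_prod_beta algebra_simps)
    qed
    from tensor_null.diff[OF tensor_null.diff[OF xs ys] this]
    have "(a - b) - (\<Sum>p\<leftarrow>xs @ ys'. frag_of p) \<in> tensor_null r l"
      by (simp add: algebra_simps)
    then show "\<exists>xs. (a - b) - (\<Sum>p\<leftarrow>xs. frag_of p) \<in> tensor_null r l" by blast
  qed
  then have "\<exists>xs. tensor_class r l c = tensor_sum r l xs" for c
    by (simp add: tensor_sum_def tensor_class_eq_iff)
  then show ?thesis
    unfolding tensor_product_def by (auto simp: image_iff) (auto simp: tensor_sum_def)
qed

lemma sweedler_exists:
  assumes "\<And>a. \<gamma> a \<in> tensor_product (bgd_ract t) (bgd_lact s)"
  shows "\<exists>d. sweedler s t \<gamma> d"
  using assms unfolding sweedler_def tensor_product_eq_range_tensor_sum image_iff by metis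

text \<open>
  \<open>twisted_S\<close> is the only \<open>k\<close>-algebra automorphism of the commutative algebra \<open>kZ\<^sub>2\<close> with
  \<open>t \<mapsto> -t\<close>.
\<close>

lemma gen_t_squared: "gen_t * gen_t = 1"
  by (simp add: gen_t_def mult_single flip: single_one)

lemma ga_scale_conv_mult: "ga_scale c p = Poly_Mapping.single 0 c * p"
  by (rule mult_map_scale_conv_mult)

lemma bit_expansion: "p = ga_scale (Poly_Mapping.lookup p 0) 1 + ga_scale (Poly_Mapping.lookup p 1) gen_t"
  for p :: "bit \<Rightarrow>\<^sub>0 'k::field"
proof (rule poly_mapping_eqI)
  fix b :: bit
  show "Poly_Mapping.lookup p b =
    Poly_Mapping.lookup (ga_scale (Poly_Mapping.lookup p 0) 1 + ga_scale (Poly_Mapping.lookup p 1) gen_t) b"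
    by (cases b) (simp_all add: ga_scale_conv_mult gen_t_def mult_single lookup_add lookup_single)
qed

lemma twisted_S_iff:
  fixes T :: "(bit \<Rightarrow>\<^sub>0 'k::field) \<Rightarrow> (bit \<Rightarrow>\<^sub>0 'k)"
  shows "T = twisted_S \<longleftrightarrow>
    ring_anti_automorphism T \<and> (\<forall>c a. T (ga_scale c a) = ga_scale c (T a)) \<and> T gen_t = - gen_t"
proof
  assume *: "ring_anti_automorphism T \<and> (\<forall>c a. T (ga_scale c a) = ga_scale c (T a)) \<and> T gen_t = - gen_t"
  show "T = twisted_S"
  proof
    fix p
    have "T p = T (ga_scale (Poly_Mapping.lookup p 0) 1 + ga_scale (Poly_Mapping.lookup p 1) gen_t)"
      using bit_expansion[of p] by simp
    also have "\<dots> = ga_scale (Poly_Mapping.lookup p 0) (T 1) + ga_scale (Poly_Mapping.lookup p 1) (T gen_t)"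
      using * unfolding ring_anti_automorphism_def by metis
    also have "\<dots> = twisted_S p"
      using * by (simp add: ring_anti_automorphism_def twisted_S_def ga_scale_conv_mult)
    finally show "T p = twisted_S p" .
  qed
next
  have form: "twisted_S p = Poly_Mapping.single 0 (Poly_Mapping.lookup p 0) -
      Poly_Mapping.single 1 (Poly_Mapping.lookup p 1)" for p :: "bit \<Rightarrow>\<^sub>0 'k"
    by (simp add: twisted_S_def ga_scale_conv_mult gen_t_def mult_single)
  have bits: "P 0 \<Longrightarrow> P 1 \<Longrightarrow> P b" for P and b :: bit
    by (cases b) auto
  have inv: "twisted_S (twisted_S p) = p" for p :: "bit \<Rightarrow>\<^sub>0 'k"
    by (rule poly_mapping_eqI, rule bits) (simp_all add: form lookup_minus lookup_single)
  have add: "twisted_S (p + q) = twisted_S p + twisted_S q" for p q :: "bit \<Rightarrow>\<^sub>0 'k"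
    by (simp add: form lookup_add single_add algebra_simps)
  have mult: "twisted_S (p * q) = twisted_S q * twisted_S p" for p q :: "bit \<Rightarrow>\<^sub>0 'k"
  proof -
    obtain a b c d where p: "p = Poly_Mapping.single 0 a + Poly_Mapping.single 1 b"
      and q: "q = Poly_Mapping.single 0 c + Poly_Mapping.single 1 d"
      using bit_expansion[of p] bit_expansion[of q]
      by (simp add: ga_scale_conv_mult gen_t_def mult_single)
    show ?thesis
      by (simp add: p q form mult_single lookup_add lookup_single single_add algebra_simps
          flip: single_diff single_uminus)
  qed
  assume T: "T = twisted_S"
  have "T 1 = 1"
    unfolding T form by (simp add: lookup_one)
  moreover have "T gen_t = - gen_t"
    unfolding T form by (simp add: gen_t_def lookup_single)
  moreover have "T (ga_scale c a) = ga_scale c (T a)" for c a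
  proof -
    have "twisted_S (Poly_Mapping.single 0 c) = (Poly_Mapping.single 0 c :: bit \<Rightarrow>\<^sub>0 'k)"
      by (simp add: form lookup_single)
    then show ?thesis
      unfolding T ga_scale_conv_mult mult by (simp add: mult.commute)
  qed
  moreover have "bij T"
    unfolding T using inv by (intro o_bij[of twisted_S]) (auto simp: fun_eq_iff)
  ultimately show
    "ring_anti_automorphism T \<and> (\<forall>c a. T (ga_scale c a) = ga_scale c (T a)) \<and> T gen_t = - gen_t"
    using add mult by (simp add: ring_anti_automorphism_def T)
qed

end

(*
  Over the base k, a sum over a Sweedler decomposition of a group algebra element p only depends on
  p: modulo any subgroup for which f is biadditive and k-balanced, it equals
  the sum of f (c g, g) over the terms c g of p. Hence every axiom reduces, by additivity, to an
  identity for p = c g, where the decomposition is c g \<otimes> g. For the twisted antipode S the signs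
  of S(g) = \<plusminus>g on the two sides agree, since the antipode occurs once on each side.
  In Lu's definition the section of the projection is forced to be the identity, because the base is k
  itself; at t its axiom reads t S(t) = \<epsilon>(t) 1, that is, -1 = 1.
*)
theory Submission
  imports Defs
begin

section \<open>Balanced maps modulo a subgroup\<close>

definition zmult :: "int \<Rightarrow> 'b::ab_group_add \<Rightarrow> 'b" where
  "zmult n x = (\<Sum>i<nat n. x) - (\<Sum>i<nat (- n). x)"

lemma zmult_0 [simp]: "zmult 0 x = 0"
  by (simp add: zmult_def)

lemma zmult_1 [simp]: "zmult 1 x = x"
  by (simp add: zmult_def)

lemma sum_const_lessThan_add:
  "(\<Sum>i<m + n. x) = (\<Sum>i<m. x) + (\<Sum>i<n. x)" for x :: "'b::ab_group_add" and m n :: nat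
  by (induction n) (simp_all add: add_ac)

text \<open>In the definition of \<open>zmult\<close>, \<open>nat\<close> makes at least one of the
  two sums empty. Here both may be nonempty and their common part cancels, so additivity in the
  integer needs no case distinction on signs.\<close>

lemma zmult_int_diff: "zmult (int m - int n) x = (\<Sum>i<m. x) - (\<Sum>i<n. x)"
proof (cases "n \<le> m")
  case True
  then obtain k where "m = n + k" by (auto simp: le_iff_add)
  then show ?thesis by (simp add: zmult_def sum_const_lessThan_add)
next
  case False
  then obtain k where "n = m + k" by (metis le_iff_add nat_le_linear)
  then show ?thesis by (simp add: zmult_def sum_const_lessThan_add)
qed

lemma zmult_diff: "zmult (a - b) x = zmult a x - zmult b x"
proof -
  obtain m n p q where "a = int m - int n" and "b = int p - int q"
    by (metis int_diff_cases)
  moreover have "(int m - int n) - (int p - int q) = int (m + q) - int (n + p)" by simp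
  ultimately show ?thesis
    by (simp only: zmult_int_diff sum_const_lessThan_add) simp
qed

text \<open>The homomorphism from the free abelian group that extends \<open>f\<close>.\<close>

definition frag_lift :: "('a \<Rightarrow> 'b::ab_group_add) \<Rightarrow> ('a \<Rightarrow>\<^sub>0 int) \<Rightarrow> 'b" where
  "frag_lift f c = (\<Sum>i\<in>Poly_Mapping.keys c. zmult (Poly_Mapping.lookup c i) (f i))"

lemma frag_lift_superset:
  assumes "finite I" "Poly_Mapping.keys c \<subseteq> I"
  shows "frag_lift f c = (\<Sum>i\<in>I. zmult (Poly_Mapping.lookup c i) (f i))"
  unfolding frag_lift_def using assms by (intro sum.mono_neutral_left) (auto simp: in_keys_iff)

lemma frag_lift_0 [simp]: "frag_lift f 0 = 0"
  by (simp add: frag_lift_def)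

lemma frag_lift_of [simp]: "frag_lift f (frag_of a) = f a"
  by (simp add: frag_lift_def keys_frag_of)

lemma frag_lift_diff: "frag_lift f (c - c') = frag_lift f c - frag_lift f c'"
proof -
  \<comment> \<open>Keys may cancel in \<open>c - c'\<close>, so all sums are taken over the union
    of both key sets.\<close>
  let ?I = "Poly_Mapping.keys c \<union> Poly_Mapping.keys c'"
  have "frag_lift f (c - c') = (\<Sum>i\<in>?I. zmult (Poly_Mapping.lookup (c - c') i) (f i))"
    by (intro frag_lift_superset keys_diff) simp
  also have "\<dots> = frag_lift f c - frag_lift f c'"
    by (simp add: frag_lift_superset[of ?I] lookup_minus zmult_diff sum_subtractf)
  finally show ?thesis .
qed

lemma frag_lift_add: "frag_lift f (c + c') = frag_lift f c + frag_lift f c'"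
  using frag_lift_diff[of f "c + c'" c'] by simp

lemma frag_lift_sum: "frag_lift f (\<Sum>i\<in>I. c i) = (\<Sum>i\<in>I. frag_lift f (c i))"
  by (induction I rule: infinite_finite_induct) (simp_all add: frag_lift_add)

lemma frag_lift_sum_list: "frag_lift f (\<Sum>p\<leftarrow>xs. frag_of p) = (\<Sum>p\<leftarrow>xs. f p)"
  by (induction xs) (simp_all add: frag_lift_add)

section \<open>Congruence modulo a subgroup\<close>

definition eq_mod :: "'b::ab_group_add \<Rightarrow> 'b set \<Rightarrow> 'b \<Rightarrow> bool"
    (\<open>(\<open>notation=\<open>mixfix eq_mod\<close>\<close>_ \<approx>\<^bsub>_\<^esub> _)\<close> [51, 0, 51] 50) where
  "x \<approx>\<^bsub>H\<^esub> y \<longleftrightarrow> x - y \<in> H"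

text \<open>Congruences replace quotient groups: the same rules serve tensor squares, triple tensors
  and, with the trivial subgroup, equalities in the algebra itself.\<close>

locale additive_subgroup =
  fixes H :: "'b::ab_group_add set"
  assumes zero_mem: "0 \<in> H"
    and diff_mem: "x \<in> H \<Longrightarrow> y \<in> H \<Longrightarrow> x - y \<in> H"
begin

lemma refl [simp, intro]: "x \<approx>\<^bsub>H\<^esub> x"
  by (simp add: eq_mod_def zero_mem)

lemma sym: "x \<approx>\<^bsub>H\<^esub> y \<Longrightarrow> y \<approx>\<^bsub>H\<^esub> x"
  using diff_mem[OF zero_mem, of "x - y"] by (simp add: eq_mod_def)

lemma diff: "x \<approx>\<^bsub>H\<^esub> y \<Longrightarrow> x' \<approx>\<^bsub>H\<^esub> y' \<Longrightarrow> x - x' \<approx>\<^bsub>H\<^esub> y - y'"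
  using diff_mem[of "x - y" "x' - y'"] by (simp add: eq_mod_def algebra_simps)

lemma add: "x \<approx>\<^bsub>H\<^esub> y \<Longrightarrow> x' \<approx>\<^bsub>H\<^esub> y' \<Longrightarrow> x + x' \<approx>\<^bsub>H\<^esub> y + y'"
  using diff[of x y "- x'" "- y'"] diff[OF refl, of x' y' 0] by simp

lemma trans [trans]: "x \<approx>\<^bsub>H\<^esub> y \<Longrightarrow> y \<approx>\<^bsub>H\<^esub> z \<Longrightarrow> x \<approx>\<^bsub>H\<^esub> z"
  using add[of x y y z] diff[of "x + y" "y + z" y y] by simp

lemma sum: "(\<And>i. i \<in> I \<Longrightarrow> f i \<approx>\<^bsub>H\<^esub> g i) \<Longrightarrow> (\<Sum>i\<in>I. f i) \<approx>\<^bsub>H\<^esub> (\<Sum>i\<in>I. g i)"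
  by (induction I rule: infinite_finite_induct) (auto intro: add)

lemma sum_list: "(\<And>i. f i \<approx>\<^bsub>H\<^esub> g i) \<Longrightarrow> (\<Sum>i\<leftarrow>xs. f i) \<approx>\<^bsub>H\<^esub> (\<Sum>i\<leftarrow>xs. g i)"
  by (induction xs) (auto intro: add)

lemma sum_list_pair:
  "(\<And>x y. f x y \<approx>\<^bsub>H\<^esub> g x y) \<Longrightarrow> (\<Sum>(x, y)\<leftarrow>xs. f x y) \<approx>\<^bsub>H\<^esub> (\<Sum>(x, y)\<leftarrow>xs. g x y)"
  by (rule sum_list) auto

lemma sum_list_pair_add:
  assumes "\<And>x y. f x y \<approx>\<^bsub>H\<^esub> g x y + h x y"
  shows "(\<Sum>(x, y)\<leftarrow>xs. f x y) \<approx>\<^bsub>H\<^esub> (\<Sum>(x, y)\<leftarrow>xs. g x y) + (\<Sum>(x, y)\<leftarrow>xs. h x y)"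
  unfolding split_def sum_list_addf[symmetric] by (rule sum_list) (rule assms)

text \<open>As \<open>F\<close> is additive only modulo \<open>H\<close>, its value at 0 need not be
  0; cancellation in \<open>F (0 + 0)\<close> gives the congruence.\<close>

lemma additive_0:
  fixes F :: "'c::monoid_add \<Rightarrow> 'b"
  assumes "\<And>x y. F (x + y) \<approx>\<^bsub>H\<^esub> F x + F y"
  shows "F 0 \<approx>\<^bsub>H\<^esub> 0"
  using sym[OF diff[OF assms[of 0 0] refl[of "F 0"]]] by simp

lemma additive_sum:
  assumes "\<And>x y. F (x + y) \<approx>\<^bsub>H\<^esub> F x + F y"
  shows "F (\<Sum>i\<in>I. x i) \<approx>\<^bsub>H\<^esub> (\<Sum>i\<in>I. F (x i))"
  by (induction I rule: infinite_finite_induct)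
    (auto intro: additive_0 assms trans[OF assms] add)

end

lemma additive_subgroup_0: "additive_subgroup {0}"
  by unfold_locales auto

lemma eq_mod_0_iff: "x \<approx>\<^bsub>{0}\<^esub> y \<longleftrightarrow> x = y"
  by (simp add: eq_mod_def)

lemma additive_subgroup_tensor_null: "additive_subgroup (tensor_null r l)"
  by unfold_locales (auto intro: tensor_null.zero tensor_null.diff)

lemma additive_subgroup_tensor3_null: "additive_subgroup (tensor3_null r l)"
  by unfold_locales (auto intro: tensor3_null.zero tensor3_null.diff)

lemma tensor_sum_eq_iff:
  "tensor_sum r l xs = tensor_sum r l ys \<longleftrightarrow>
     (\<Sum>p\<leftarrow>xs. frag_of p) \<approx>\<^bsub>tensor_null r l\<^esub> (\<Sum>p\<leftarrow>ys. frag_of p)"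
  by (simp add: tensor_sum_def tensor_class_eq_iff eq_mod_def)

lemma tensor3_sum_eqI:
  assumes "(\<Sum>p\<leftarrow>xs. frag_of p) \<approx>\<^bsub>tensor3_null r l\<^esub> (\<Sum>p\<leftarrow>ys. frag_of p)"
  shows "tensor3_sum r l xs = tensor3_sum r l ys"
proof -
  interpret additive_subgroup "tensor3_null r l"
    by (rule additive_subgroup_tensor3_null)
  show ?thesis
    using assms by (auto simp: tensor3_sum_def simp flip: eq_mod_def intro: trans sym)
qed

section \<open>Balanced maps and the universal property of tensor products\<close>

locale balanced_map = additive_subgroup H
  for H :: "'b::ab_group_add set" +
  fixes ract :: "'m::ab_group_add \<Rightarrow> 'l \<Rightarrow> 'm" and lact :: "'l \<Rightarrow> 'n::ab_group_add \<Rightarrow> 'n"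
    and f :: "'m \<Rightarrow> 'n \<Rightarrow> 'b"
  assumes add_left: "f (x + x') y \<approx>\<^bsub>H\<^esub> f x y + f x' y"
    and add_right: "f x (y + y') \<approx>\<^bsub>H\<^esub> f x y + f x y'"
    and balanced: "f (ract x l) y \<approx>\<^bsub>H\<^esub> f x (lact l y)"
begin

text \<open>Each generator of \<open>tensor_null\<close> is a relation that \<open>f\<close>
  respects modulo \<open>H\<close>, so the extension of \<open>f\<close> to formal sums descends to
  the tensor product.\<close>

lemma frag_lift_tensor_null:
  "c \<in> tensor_null ract lact \<Longrightarrow> frag_lift (\<lambda>(x, y). f x y) c \<in> H"
proof (induction rule: tensor_null.induct)
  case prems: (add_left x x' y)
  show ?case using add_left[of x x' y]
    by (simp add: frag_lift_diff frag_lift_add eq_mod_def diff_diff_eq)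
next
  case prems: (add_right x y y')
  show ?case using add_right[of x y y']
    by (simp add: frag_lift_diff frag_lift_add eq_mod_def diff_diff_eq)
next
  case prems: (balanced x l y)
  show ?case using balanced[of x l y]
    by (simp add: frag_lift_diff eq_mod_def)
qed (simp_all add: zero_mem diff_mem frag_lift_diff)

lemma frag_lift_cong:
  assumes "tensor_class ract lact c = tensor_class ract lact c'"
  shows "frag_lift (\<lambda>(x, y). f x y) c \<approx>\<^bsub>H\<^esub> frag_lift (\<lambda>(x, y). f x y) c'"
  using frag_lift_tensor_null[of "c - c'"] assms
  by (simp add: tensor_class_eq_iff eq_mod_def frag_lift_diff)

end

text \<open>This is the universal balanced map. Taken as \<open>f\<close>, it turns congruences
  between Sweedler sums into equalities of tensors.\<close>

lemma balanced_map_frag_of: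
  "balanced_map (tensor_null r l) r l (\<lambda>x y. frag_of (x, y))"
proof -
  interpret additive_subgroup "tensor_null r l"
    by (rule additive_subgroup_tensor_null)
  show ?thesis
    by unfold_locales
      (simp_all only: eq_mod_def tensor_null.balanced
        tensor_null.add_left[unfolded diff_diff_eq] tensor_null.add_right[unfolded diff_diff_eq])
qed

text \<open>Coassociativity applies the comultiplication to a single leg; this lemma and its mirror
  image freeze the remaining leg.\<close>

lemma balanced_map_tensor3_left:
  "balanced_map (tensor3_null r l) r l (\<lambda>x y. frag_of (x, y, z))"
proof -
  interpret additive_subgroup "tensor3_null r l"
    by (rule additive_subgroup_tensor3_null)
  show ?thesis
    by unfold_locales
      (simp_all only: eq_mod_def tensor3_null.balanced12
        tensor3_null.add1[unfolded diff_diff_eq] tensor3_null.add2[unfolded diff_diff_eq])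
qed

lemma balanced_map_tensor3_right:
  "balanced_map (tensor3_null r l) r l (\<lambda>y z. frag_of (x, y, z))"
proof -
  interpret additive_subgroup "tensor3_null r l"
    by (rule additive_subgroup_tensor3_null)
  show ?thesis
    by unfold_locales
      (simp_all only: eq_mod_def tensor3_null.balanced23
        tensor3_null.add2[unfolded diff_diff_eq] tensor3_null.add3[unfolded diff_diff_eq])
qed

section \<open>The group bialgebra\<close>

lemma ga_unit_def': "ga_unit c = Poly_Mapping.single 0 c"
  by (simp add: ga_unit_def ga_scale_conv_mult)

lemma ga_unit_times_single: "ga_unit c * Poly_Mapping.single g e = Poly_Mapping.single g (c * e)"
  by (simp add: ga_unit_def' mult_single)

lemma ga_unit_add: "ga_unit (c + e) = ga_unit c + ga_unit e"
  by (simp add: ga_unit_def' single_add)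

lemma ga_unit_mult: "ga_unit (c * e) = ga_unit c * ga_unit e"
  by (simp add: ga_unit_def' mult_single)

lemma ga_unit_1 [simp]: "ga_unit 1 = 1"
  by (simp add: ga_unit_def')

lemma ga_scale_conv_unit: "ga_scale c p = ga_unit c * p"
  by (simp add: ga_unit_def' ga_scale_conv_mult)

text \<open>The unapplied form rewrites \<open>ga_scale\<close> where it stands as an action in a
  tensor product: tensoring over k by scaling becomes tensoring along the unit map.\<close>

lemma ga_scale_eq: "ga_scale = (\<lambda>c p. ga_unit c * p)"
  by (intro ext ga_scale_conv_unit)

lemma sum_single: "(\<Sum>g\<in>Poly_Mapping.keys p. Poly_Mapping.single g (Poly_Mapping.lookup p g)) = p"
proof (rule poly_mapping_eqI)
  fix h
  have "(\<Sum>g\<in>Poly_Mapping.keys p. Poly_Mapping.lookup p g when g = h)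
      = (\<Sum>g\<in>Poly_Mapping.keys p. if g = h then Poly_Mapping.lookup p g else 0)"
    by (simp only: when_def)
  also have "\<dots> = Poly_Mapping.lookup p h"
    by (simp only: sum.delta[OF finite_keys] in_keys_iff) auto
  finally show "Poly_Mapping.lookup (\<Sum>g\<in>Poly_Mapping.keys p. Poly_Mapping.single g (Poly_Mapping.lookup p g)) h
      = Poly_Mapping.lookup p h"
    by (simp only: lookup_sum lookup_single)
qed

text \<open>Every element is the sum of its terms \<open>Poly_Mapping.single g c\<close>, and
  additivity modulo \<open>H\<close> distributes both maps over that sum.\<close>

lemma additive_eqI:
  fixes F G :: "('g \<Rightarrow>\<^sub>0 'k::ab_group_add) \<Rightarrow> 'b::ab_group_add"
  assumes "additive_subgroup H"
    and "\<And>x y. F (x + y) \<approx>\<^bsub>H\<^esub> F x + F y" "\<And>x y. G (x + y) \<approx>\<^bsub>H\<^esub> G x + G y"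
    and "\<And>g c. F (Poly_Mapping.single g c) \<approx>\<^bsub>H\<^esub> G (Poly_Mapping.single g c)"
  shows "F p \<approx>\<^bsub>H\<^esub> G p"
proof -
  interpret additive_subgroup H by fact
  let ?x = "\<lambda>g. Poly_Mapping.single g (Poly_Mapping.lookup p g)"
  have "F (\<Sum>g\<in>Poly_Mapping.keys p. ?x g) \<approx>\<^bsub>H\<^esub> (\<Sum>g\<in>Poly_Mapping.keys p. F (?x g))"
    by (rule additive_sum) (rule assms(2))
  also have "\<dots> \<approx>\<^bsub>H\<^esub> (\<Sum>g\<in>Poly_Mapping.keys p. G (?x g))"
    by (rule sum) (rule assms(4))
  also have "\<dots> \<approx>\<^bsub>H\<^esub> G (\<Sum>g\<in>Poly_Mapping.keys p. ?x g)"
    by (rule sym, rule additive_sum) (rule assms(3))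
  finally show ?thesis by (simp add: sum_single)
qed

text \<open>Scalars sit at the identity 0 of a possibly noncommutative group, and 0 + g = g +
  0.\<close>

lemma ga_unit_commute: "ga_unit c * p = p * ga_unit c" for p :: "'g::group_add \<Rightarrow>\<^sub>0 'k::field"
proof -
  have "ga_unit c * p \<approx>\<^bsub>{0}\<^esub> p * ga_unit c"
    by (rule additive_eqI[OF additive_subgroup_0])
      (simp_all add: eq_mod_0_iff distrib_left distrib_right ga_unit_def' mult_single mult.commute)
  then show ?thesis by (simp add: eq_mod_0_iff)
qed

lemma ga_unit_left_commute: "p * (ga_unit c * q) = ga_unit c * (p * q)"
  for p :: "'g::group_add \<Rightarrow>\<^sub>0 'k::field"
  by (metis ga_unit_commute mult.assoc)

text \<open>The two scalars change order because this is the shape in which balancing appears in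
  both counit laws, with \<open>e\<close> a value of the counit.\<close>

lemma ga_unit_mult_times: "ga_unit (c * e) * p = ga_unit e * (ga_unit c * p)"
  by (simp add: mult.commute[of c] ga_unit_mult mult.assoc)

section \<open>Diagonal sums over the terms of a group algebra element\<close>

abbreviation ga_act :: "'k::field \<Rightarrow> ('g::group_add \<Rightarrow>\<^sub>0 'k) \<Rightarrow> ('g \<Rightarrow>\<^sub>0 'k)" where
  "ga_act \<equiv> \<lambda>c p. ga_unit c * p"

text \<open>Source and target are the same unit map, so the two actions of the base differ only in
  the order of arguments.\<close>

abbreviation ga_act' :: "('g::group_add \<Rightarrow>\<^sub>0 'k::field) \<Rightarrow> 'k \<Rightarrow> ('g \<Rightarrow>\<^sub>0 'k)" where
  "ga_act' \<equiv> \<lambda>p c. ga_unit c * p"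

abbreviation ga_null :: "(('g::group_add \<Rightarrow>\<^sub>0 'k::field) \<times> ('g \<Rightarrow>\<^sub>0 'k) \<Rightarrow>\<^sub>0 int) set" where
  "ga_null \<equiv> tensor_null ga_act' ga_act"

text \<open>The value of \<open>f\<close> on the canonical representative of the comultiplication,
  the sum of c g \<otimes> g over the terms c g of \<open>p\<close>. The coefficient sits in the
  left leg.\<close>

definition diag_sum ::
  "(('g \<Rightarrow>\<^sub>0 'k) \<Rightarrow> ('g \<Rightarrow>\<^sub>0 'k) \<Rightarrow> 'b::ab_group_add) \<Rightarrow> ('g \<Rightarrow>\<^sub>0 'k::field) \<Rightarrow> 'b" where
  "diag_sum f p = (\<Sum>g\<in>Poly_Mapping.keys p.
     f (Poly_Mapping.single g (Poly_Mapping.lookup p g)) (Poly_Mapping.single g 1))"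

lemma ga_comult_conv_diag_sum:
  "ga_comult p = tensor_class ga_act' ga_act (diag_sum (\<lambda>x y. frag_of (x, y)) p)"
  by (simp only: ga_comult_def diag_sum_def ga_scale_eq ga_scale_conv_unit)

locale ga_balanced_map = balanced_map H ga_act' ga_act f
  for H :: "'b::ab_group_add set"
    and f :: "('g::group_add \<Rightarrow>\<^sub>0 'k::field) \<Rightarrow> ('g \<Rightarrow>\<^sub>0 'k) \<Rightarrow> 'b"
begin

lemma zero_left: "f 0 y \<approx>\<^bsub>H\<^esub> 0"
  by (rule additive_0[of "\<lambda>x. f x y"]) (rule add_left)

text \<open>A group element outside the support contributes \<open>f 0 y\<close>, which vanishes
  modulo \<open>H\<close>.\<close>

lemma diag_sum_superset:
  assumes "finite I" "Poly_Mapping.keys p \<subseteq> I"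
  shows "diag_sum f p \<approx>\<^bsub>H\<^esub>
    (\<Sum>g\<in>I. f (Poly_Mapping.single g (Poly_Mapping.lookup p g)) (Poly_Mapping.single g 1))"
proof -
  let ?t = "\<lambda>g. f (Poly_Mapping.single g (Poly_Mapping.lookup p g)) (Poly_Mapping.single g 1)"
  have "(\<Sum>g\<in>I. ?t g) \<approx>\<^bsub>H\<^esub> (\<Sum>g\<in>I. if g \<in> Poly_Mapping.keys p then ?t g else 0)"
    by (rule sum) (auto simp: in_keys_iff intro: zero_left)
  also have "(\<Sum>g\<in>I. if g \<in> Poly_Mapping.keys p then ?t g else 0) = diag_sum f p"
    unfolding diag_sum_def using assms by (simp flip: sum.inter_restrict add: Int_absorb1)
  finally show ?thesis by (rule sym)
qed

text \<open>Terms of \<open>p + q\<close> may cancel, so everything is expanded over the union of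
  the supports, where the coefficients add in the left leg.\<close>

lemma diag_sum_add: "diag_sum f (p + q) \<approx>\<^bsub>H\<^esub> diag_sum f p + diag_sum f q"
proof -
  let ?I = "Poly_Mapping.keys p \<union> Poly_Mapping.keys q"
  let ?t = "\<lambda>p g. f (Poly_Mapping.single g (Poly_Mapping.lookup p g)) (Poly_Mapping.single g 1)"
  have "diag_sum f (p + q) \<approx>\<^bsub>H\<^esub> (\<Sum>g\<in>?I. ?t (p + q) g)"
    by (intro diag_sum_superset keys_add) simp
  also have "(\<Sum>g\<in>?I. ?t (p + q) g) \<approx>\<^bsub>H\<^esub> (\<Sum>g\<in>?I. ?t p g + ?t q g)"
    by (intro sum) (simp add: lookup_add single_add add_left)
  also have "(\<Sum>g\<in>?I. ?t p g + ?t q g) \<approx>\<^bsub>H\<^esub> diag_sum f p + diag_sum f q"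
    unfolding sum.distrib by (intro add sym[OF diag_sum_superset]) auto
  finally show ?thesis .
qed

text \<open>The detour through a superset of the support covers c = 0, where the support is
  empty.\<close>

lemma diag_sum_single:
  "diag_sum f (Poly_Mapping.single g c) \<approx>\<^bsub>H\<^esub> f (Poly_Mapping.single g c) (Poly_Mapping.single g 1)"
  using diag_sum_superset[of "{g}" "Poly_Mapping.single g c"] by simp

lemma diag_sum_eqI:
  assumes "\<And>x y. F (x + y) \<approx>\<^bsub>H\<^esub> F x + F y"
    and "\<And>g c. f (Poly_Mapping.single g c) (Poly_Mapping.single g 1) \<approx>\<^bsub>H\<^esub> F (Poly_Mapping.single g c)"
  shows "diag_sum f p \<approx>\<^bsub>H\<^esub> F p"
  by (rule additive_eqI[where F = "diag_sum f" and G = F, OF additive_subgroup_axioms diag_sum_add assms(1)])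
    (rule trans[OF diag_sum_single assms(2)])

end

text \<open>Central scalars pass through fixed factors on either side. Setting some factors to 1
  yields the scaled and multiplied maps used below.\<close>

lemma (in ga_balanced_map) ga_balanced_map_mult:
  "ga_balanced_map H (\<lambda>x y. f (a * x * a') (b * y * b'))"
proof unfold_locales
  fix x y c
  show "f (a * (ga_unit c * x) * a') (b * y * b') \<approx>\<^bsub>H\<^esub> f (a * x * a') (b * (ga_unit c * y) * b')"
    using balanced[of c "a * x * a'" "b * y * b'"] by (simp add: mult.assoc ga_unit_left_commute)
qed (simp_all add: distrib_left distrib_right add_left add_right)

lemma ga_balanced_map_frag_of: "ga_balanced_map ga_null (\<lambda>x y. frag_of (x, y))"
  by (simp add: ga_balanced_map_def balanced_map_frag_of)

section \<open>Sums over arbitrary Sweedler decompositions\<close>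

locale ga_sweedler =
  fixes d :: "('g::group_add \<Rightarrow>\<^sub>0 'k::field) \<Rightarrow> (('g \<Rightarrow>\<^sub>0 'k) \<times> ('g \<Rightarrow>\<^sub>0 'k)) list"
  assumes sweedler: "sweedler ga_unit ga_unit ga_comult d"

locale ga_sweedler_map = ga_sweedler d + ga_balanced_map H f
  for d :: "('g::group_add \<Rightarrow>\<^sub>0 'k::field) \<Rightarrow> (('g \<Rightarrow>\<^sub>0 'k) \<times> ('g \<Rightarrow>\<^sub>0 'k)) list"
    and H :: "'b::ab_group_add set"
    and f :: "('g \<Rightarrow>\<^sub>0 'k) \<Rightarrow> ('g \<Rightarrow>\<^sub>0 'k) \<Rightarrow> 'b"

lemma (in ga_sweedler) ga_sweedler_map_iff: "ga_sweedler_map d H f \<longleftrightarrow> ga_balanced_map H f"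
  by (simp add: ga_sweedler_map_def ga_sweedler_axioms)

context ga_sweedler_map
begin

text \<open>The chosen list and the canonical representative stand for the same tensor, so a
  balanced map cannot distinguish them modulo \<open>H\<close>. This removes the dependence on the
  choice \<open>d\<close>.\<close>

lemma sweedler_diag_sum: "(\<Sum>(x, y)\<leftarrow>d p. f x y) \<approx>\<^bsub>H\<^esub> diag_sum f p"
proof -
  have "tensor_class ga_act' ga_act (\<Sum>p\<leftarrow>d p. frag_of p)
      = tensor_class ga_act' ga_act (diag_sum (\<lambda>x y. frag_of (x, y)) p)"
    using sweedler by (simp add: sweedler_def tensor_sum_def flip: ga_comult_conv_diag_sum)
  from frag_lift_cong[OF this] show ?thesis
    by (simp add: frag_lift_sum_list diag_sum_def frag_lift_sum)
qed

lemma sweedler_single: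
  "(\<Sum>(x, y)\<leftarrow>d (Poly_Mapping.single g c). f x y)
     \<approx>\<^bsub>H\<^esub> f (Poly_Mapping.single g c) (Poly_Mapping.single g 1)"
  by (rule trans[OF sweedler_diag_sum diag_sum_single])

text \<open>The list chosen for \<open>p + q\<close> bears no relation to those for \<open>p\<close>
  and \<open>q\<close>; all three are compared through diagonal sums.\<close>

lemma sweedler_add:
  "(\<Sum>(x, y)\<leftarrow>d (p + q). f x y) \<approx>\<^bsub>H\<^esub> (\<Sum>(x, y)\<leftarrow>d p. f x y) + (\<Sum>(x, y)\<leftarrow>d q. f x y)"
  by (intro trans[OF sweedler_diag_sum] trans[OF diag_sum_add] add sym[OF sweedler_diag_sum])

lemma sweedler_eqI:
  assumes "\<And>x y. F (x + y) \<approx>\<^bsub>H\<^esub> F x + F y"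
    and "\<And>g c. f (Poly_Mapping.single g c) (Poly_Mapping.single g 1) \<approx>\<^bsub>H\<^esub> F (Poly_Mapping.single g c)"
  shows "(\<Sum>(x, y)\<leftarrow>d p. f x y) \<approx>\<^bsub>H\<^esub> F p"
  by (rule trans[OF sweedler_diag_sum diag_sum_eqI]) fact+

text \<open>Both sides are additive in \<open>p\<close> and agree on single terms. The rule makes
  nested Sweedler sums balanced in their outer variables.\<close>

lemma sweedler_scale:
  "(\<Sum>(x, y)\<leftarrow>d (ga_unit c * p). f x y) \<approx>\<^bsub>H\<^esub> (\<Sum>(x, y)\<leftarrow>d p. f (ga_unit c * x) y)"
proof (rule sym)
  interpret scaled: ga_sweedler_map d H "\<lambda>x y. f (ga_unit c * x) y"
    unfolding ga_sweedler_map_iff using ga_balanced_map_mult[of "ga_unit c" 1 1 1] by simp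
  show "(\<Sum>(x, y)\<leftarrow>d p. f (ga_unit c * x) y) \<approx>\<^bsub>H\<^esub> (\<Sum>(x, y)\<leftarrow>d (ga_unit c * p). f x y)"
    by (rule scaled.sweedler_eqI)
      (simp_all add: distrib_left sweedler_add ga_unit_times_single sym[OF sweedler_single])
qed

end

context ga_sweedler
begin

text \<open>One factor is reduced at a time: the sum over \<open>d q\<close> is itself a balanced
  map for \<open>d p\<close>. For terms c g and e h both sides give the value of \<open>f\<close> at
  (c e) gh and gh.\<close>

lemma sweedler_comult_mult:
  assumes "ga_balanced_map H f"
  shows "(\<Sum>(x, y)\<leftarrow>d p. \<Sum>(u, v)\<leftarrow>d q. f (x * u) (y * v)) \<approx>\<^bsub>H\<^esub> diag_sum f (p * q)"
proof -
  interpret f: ga_balanced_map H f by fact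
  have right: "ga_sweedler_map d H (\<lambda>u v. f (x * u) (y * v))" for x y
    using f.ga_balanced_map_mult[of x 1 y 1] by (simp add: ga_sweedler_map_iff)
  have left: "ga_sweedler_map d H (\<lambda>x y. \<Sum>(u, v)\<leftarrow>d q. f (x * u) (y * v))"
    unfolding ga_sweedler_map_iff
  proof unfold_locales
    fix x y c
    show "(\<Sum>(u, v)\<leftarrow>d q. f (ga_unit c * x * u) (y * v))
        \<approx>\<^bsub>H\<^esub> (\<Sum>(u, v)\<leftarrow>d q. f (x * u) (ga_unit c * y * v))"
      by (intro f.sum_list_pair) (simp add: mult.assoc f.balanced)
  qed (simp_all add: distrib_right f.add_left f.add_right f.sum_list_pair_add)
  show ?thesis
  proof (rule ga_sweedler_map.sweedler_eqI[OF left])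
    show "(\<Sum>(u, v)\<leftarrow>d q. f (Poly_Mapping.single g c * u) (Poly_Mapping.single g 1 * v))
        \<approx>\<^bsub>H\<^esub> diag_sum f (Poly_Mapping.single g c * q)" for g c
      by (rule ga_sweedler_map.sweedler_eqI[OF right])
        (simp_all add: distrib_left mult_single f.diag_sum_add f.sym[OF f.diag_sum_single])
  qed (simp add: distrib_right f.diag_sum_add)
qed

end

text \<open>For a term c g both sides reduce to c g \<otimes> g \<otimes> g. The work lies in
  showing that each inner sum is balanced in the outer decomposition.\<close>

lemma (in ga_sweedler) sweedler_coassoc:
  fixes p :: "'g \<Rightarrow>\<^sub>0 'k"
  shows "(\<Sum>(x, y)\<leftarrow>d p. \<Sum>(u, v)\<leftarrow>d x. frag_of (u, v, y)) \<approx>\<^bsub>tensor3_null ga_act' ga_act\<^esub>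
    (\<Sum>(x, y)\<leftarrow>d p. \<Sum>(u, v)\<leftarrow>d y. frag_of (x, u, v))"
proof -
  interpret L: ga_sweedler_map d "tensor3_null ga_act' ga_act" "\<lambda>x y. frag_of (x, y, z)" for z
    by (simp add: ga_sweedler_map_iff ga_balanced_map_def balanced_map_tensor3_left)
  interpret R: ga_sweedler_map d "tensor3_null ga_act' ga_act" "\<lambda>y z. frag_of (x, y, z)" for x
    by (simp add: ga_sweedler_map_iff ga_balanced_map_def balanced_map_tensor3_right)
  interpret LL: ga_sweedler_map d "tensor3_null ga_act' ga_act"
      "\<lambda>x y. \<Sum>(u, v)\<leftarrow>d x. frag_of (u, v, y)"
    unfolding ga_sweedler_map_iff
  proof unfold_locales
    fix x y :: "'g \<Rightarrow>\<^sub>0 'k" and c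
    have "(\<Sum>(u, v)\<leftarrow>d (ga_unit c * x). frag_of (u, v, y))
        \<approx>\<^bsub>tensor3_null ga_act' ga_act\<^esub> (\<Sum>(u, v)\<leftarrow>d x. frag_of (ga_unit c * u, v, y))"
      by (rule L.sweedler_scale)
    \<comment> \<open>The scalar crosses both tensor signs, from the first leg through the second to
      the third.\<close>
    also have "(\<Sum>(u, v)\<leftarrow>d x. frag_of (ga_unit c * u, v, y))
        \<approx>\<^bsub>tensor3_null ga_act' ga_act\<^esub> (\<Sum>(u, v)\<leftarrow>d x. frag_of (u, v, ga_unit c * y))"
      by (intro L.sum_list_pair L.trans[OF L.balanced R.balanced])
    finally show "(\<Sum>(u, v)\<leftarrow>d (ga_unit c * x). frag_of (u, v, y))
        \<approx>\<^bsub>tensor3_null ga_act' ga_act\<^esub> (\<Sum>(u, v)\<leftarrow>d x. frag_of (u, v, ga_unit c * y))" .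
  qed (simp_all add: L.sweedler_add R.add_right L.sum_list_pair_add)
  interpret RR: ga_sweedler_map d "tensor3_null ga_act' ga_act"
      "\<lambda>x y. \<Sum>(u, v)\<leftarrow>d y. frag_of (x, u, v)"
    unfolding ga_sweedler_map_iff
  proof unfold_locales
    fix x y :: "'g \<Rightarrow>\<^sub>0 'k" and c
    have "(\<Sum>(u, v)\<leftarrow>d y. frag_of (ga_unit c * x, u, v))
        \<approx>\<^bsub>tensor3_null ga_act' ga_act\<^esub> (\<Sum>(u, v)\<leftarrow>d y. frag_of (x, ga_unit c * u, v))"
      by (intro L.sum_list_pair L.balanced)
    also have "(\<Sum>(u, v)\<leftarrow>d y. frag_of (x, ga_unit c * u, v))
        \<approx>\<^bsub>tensor3_null ga_act' ga_act\<^esub> (\<Sum>(u, v)\<leftarrow>d (ga_unit c * y). frag_of (x, u, v))"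
      by (rule L.sym[OF R.sweedler_scale])
    finally show "(\<Sum>(u, v)\<leftarrow>d y. frag_of (ga_unit c * x, u, v))
        \<approx>\<^bsub>tensor3_null ga_act' ga_act\<^esub> (\<Sum>(u, v)\<leftarrow>d (ga_unit c * y). frag_of (x, u, v))" .
  qed (simp_all add: R.sweedler_add L.add_left L.sum_list_pair_add)
  show ?thesis
    by (rule LL.sweedler_eqI[OF RR.sweedler_add])
      (intro L.trans[OF L.sweedler_single]
        L.sym[OF L.trans[OF RR.sweedler_single R.sweedler_single]])
qed

section \<open>The counit\<close>

lemma ga_counit_add: "ga_counit (p + q) = ga_counit p + ga_counit q"
  unfolding ga_counit_def by (rule setsum_keys_plus_distrib) simp_all

lemma ga_counit_single [simp]: "ga_counit (Poly_Mapping.single g c) = c"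
  by (simp add: ga_counit_def)

lemma ga_counit_unit [simp]: "ga_counit (ga_unit c) = c"
  by (simp add: ga_unit_def')

lemma ga_counit_1 [simp]: "ga_counit 1 = 1"
  by (metis ga_unit_1 ga_counit_unit)

lemma ga_counit_mult: "ga_counit (p * q) = ga_counit p * ga_counit q"
proof -
  have "ga_counit (Poly_Mapping.single g c * q) \<approx>\<^bsub>{0}\<^esub> c * ga_counit q" for g c
    by (rule additive_eqI[OF additive_subgroup_0])
      (simp_all add: eq_mod_0_iff distrib_left ga_counit_add mult_single)
  then have "ga_counit (p * q) \<approx>\<^bsub>{0}\<^esub> ga_counit p * ga_counit q"
    using additive_eqI[OF additive_subgroup_0, of "\<lambda>p. ga_counit (p * q)"
        "\<lambda>p. ga_counit p * ga_counit q" p]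
    by (simp add: eq_mod_0_iff distrib_right ga_counit_add)
  then show ?thesis by (simp add: eq_mod_0_iff)
qed

section \<open>The bialgebroid axioms for a group algebra\<close>

lemma tens_eq_ga_comult_iff:
  "tens ga_unit ga_unit xs = ga_comult p \<longleftrightarrow>
     (\<Sum>p\<leftarrow>xs. frag_of p) \<approx>\<^bsub>ga_null\<^esub> diag_sum (\<lambda>x y. frag_of (x, y)) p"
  by (simp add: tensor_sum_def ga_comult_conv_diag_sum tensor_class_eq_iff eq_mod_def)

text \<open>The axioms are stated with list comprehensions; the lemmas on Sweedler sums apply to
  iterated sums.\<close>

lemma sum_list_map_pairs:
  "(\<Sum>p\<leftarrow>[h x y. (x, y) \<leftarrow> xs]. F p) = (\<Sum>(x, y)\<leftarrow>xs. F (h x y))"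
  for F :: "_ \<Rightarrow> 'b::comm_monoid_add"
  by (simp add: split_def comp_def)

lemma sum_list_map_pairs2:
  "(\<Sum>p\<leftarrow>[h x y u v. (x, y) \<leftarrow> xs, (u, v) \<leftarrow> g x y]. F p)
     = (\<Sum>(x, y)\<leftarrow>xs. \<Sum>(u, v)\<leftarrow>g x y. F (h x y u v))"
  for F :: "_ \<Rightarrow> 'b::comm_monoid_add"
  by (induction xs) (auto simp: split_def comp_def)

theorem left_bialgebroid_group_algebra:
  "left_bialgebroid ga_unit ga_unit
     (ga_comult :: ('g::group_add \<Rightarrow>\<^sub>0 'k::field) \<Rightarrow> _) ga_counit"
proof -
  interpret N: ga_balanced_map ga_null
      "\<lambda>x y. frag_of (x, y) :: ('g \<Rightarrow>\<^sub>0 'k) \<times> ('g \<Rightarrow>\<^sub>0 'k) \<Rightarrow>\<^sub>0 int"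
    by (rule ga_balanced_map_frag_of)
  show ?thesis
  proof
    fix l l' :: 'k
    show "ga_unit (l + l') = (ga_unit l + ga_unit l' :: 'g \<Rightarrow>\<^sub>0 'k)"
      by (rule ga_unit_add)
    show "ga_unit (l * l') = (ga_unit l * ga_unit l' :: 'g \<Rightarrow>\<^sub>0 'k)"
      by (rule ga_unit_mult)
    show "ga_unit (l * l') = (ga_unit l' * ga_unit l :: 'g \<Rightarrow>\<^sub>0 'k)"
      by (metis ga_unit_mult ga_unit_commute)
    show "ga_unit l * ga_unit l' = (ga_unit l' * ga_unit l :: 'g \<Rightarrow>\<^sub>0 'k)"
      by (rule ga_unit_commute)
    fix a b :: "'g \<Rightarrow>\<^sub>0 'k"
    show "ga_comult a \<in> tensor_product ga_act' ga_act"
      by (simp add: tensor_product_def ga_comult_conv_diag_sum)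
    show "ga_counit (a + b) = ga_counit a + ga_counit b"
      by (rule ga_counit_add)
    show "ga_counit (ga_unit l * ga_unit l' * a) = l * ga_counit a * l'"
      by (simp add: ga_counit_mult)
    show "ga_counit (a * ga_unit (ga_counit b)) = ga_counit (a * b)"
      by (simp add: ga_counit_mult)
    show "ga_comult 1 = tens ga_unit ga_unit [(1 :: 'g \<Rightarrow>\<^sub>0 'k, 1)]"
      \<comment> \<open>The unit is the basis element of the group identity 0, hence
        grouplike.\<close>
      using N.sym[OF N.diag_sum_single[of 0 1]]
      by (intro sym[where t = "ga_comult 1"]) (simp add: tens_eq_ga_comult_iff)
    fix d :: "('g \<Rightarrow>\<^sub>0 'k) \<Rightarrow> (('g \<Rightarrow>\<^sub>0 'k) \<times> ('g \<Rightarrow>\<^sub>0 'k)) list"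
    assume "sweedler ga_unit ga_unit ga_comult d"
    then interpret ga_sweedler d by unfold_locales
    interpret F: ga_sweedler_map d ga_null "\<lambda>x y. frag_of (x, y)"
      by unfold_locales
    show "ga_comult (a + b) = tens ga_unit ga_unit (d a @ d b)"
    proof (rule sym, unfold tens_eq_ga_comult_iff)
      show "(\<Sum>p\<leftarrow>d a @ d b. frag_of p) \<approx>\<^bsub>ga_null\<^esub> diag_sum (\<lambda>x y. frag_of (x, y)) (a + b)"
        using N.trans[OF N.add[OF F.sweedler_diag_sum F.sweedler_diag_sum] N.sym[OF N.diag_sum_add],
            of a b]
        by (simp add: split_def)
    qed
    show "ga_comult (ga_unit l * ga_unit l' * a)
        = tens ga_unit ga_unit [(ga_unit l * x, ga_unit l' * y). (x, y) \<leftarrow> d a]"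
    proof (rule sym, unfold tens_eq_ga_comult_iff sum_list_map_pairs)
      interpret M: ga_sweedler_map d ga_null "\<lambda>x y. frag_of (ga_unit l * x, ga_unit l' * y)"
        using N.ga_balanced_map_mult[of "ga_unit l" 1 "ga_unit l'" 1]
        by (simp add: ga_sweedler_map_iff)
      show "(\<Sum>(x, y)\<leftarrow>d a. frag_of (ga_unit l * x, ga_unit l' * y))
          \<approx>\<^bsub>ga_null\<^esub> diag_sum (\<lambda>x y. frag_of (x, y)) (ga_unit l * ga_unit l' * a)"
      proof (rule M.sweedler_eqI)
        fix g :: 'g and c :: 'k
        \<comment> \<open>Balancing moves \<open>l'\<close> to the left leg, because
          \<open>diag_sum\<close> keeps the whole coefficient there.\<close>
        have "frag_of (ga_unit l * Poly_Mapping.single g c, ga_unit l' * Poly_Mapping.single g 1)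
            \<approx>\<^bsub>ga_null\<^esub> frag_of (ga_unit l' * (ga_unit l * Poly_Mapping.single g c), Poly_Mapping.single g 1)"
          by (rule N.sym[OF N.balanced])
        also have "\<dots> = frag_of (Poly_Mapping.single g (l' * (l * c)), Poly_Mapping.single g 1)"
          by (simp add: ga_unit_times_single)
        also have "\<dots> \<approx>\<^bsub>ga_null\<^esub> diag_sum (\<lambda>x y. frag_of (x, y)) (Poly_Mapping.single g (l' * (l * c)))"
          by (rule N.sym[OF N.diag_sum_single])
        finally show "frag_of (ga_unit l * Poly_Mapping.single g c, ga_unit l' * Poly_Mapping.single g 1)
            \<approx>\<^bsub>ga_null\<^esub> diag_sum (\<lambda>x y. frag_of (x, y))
              (ga_unit l * ga_unit l' * Poly_Mapping.single g c)"
          by (simp add: ga_unit_times_single mult.assoc mult.left_commute)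
      qed (simp add: distrib_left N.diag_sum_add)
    qed
    show "tens3 ga_unit ga_unit [(u, v, y). (x, y) \<leftarrow> d a, (u, v) \<leftarrow> d x]
        = tens3 ga_unit ga_unit [(x, u, v). (x, y) \<leftarrow> d a, (u, v) \<leftarrow> d y]"
      by (rule tensor3_sum_eqI, unfold sum_list_map_pairs2) (rule sweedler_coassoc)
    show "(\<Sum>(x, y)\<leftarrow>d a. ga_unit (ga_counit x) * y) = a"
    proof -
      interpret additive_subgroup "{0} :: ('g \<Rightarrow>\<^sub>0 'k) set" by (rule additive_subgroup_0)
      \<comment> \<open>On c g \<otimes> g the counit extracts c from the left leg and returns it to
        the right one.\<close>
      interpret C: ga_sweedler_map d "{0}" "\<lambda>x y. ga_unit (ga_counit x) * y"
        by unfold_locales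
          (simp_all add: eq_mod_0_iff distrib_left distrib_right ga_counit_add ga_unit_add
            ga_counit_mult ga_unit_mult_times)
      show ?thesis
        using C.sweedler_eqI[of "\<lambda>a. a" a] by (simp add: eq_mod_0_iff ga_unit_times_single)
    qed
    show "(\<Sum>(x, y)\<leftarrow>d a. ga_unit (ga_counit y) * x) = a"
    proof -
      interpret additive_subgroup "{0} :: ('g \<Rightarrow>\<^sub>0 'k) set" by (rule additive_subgroup_0)
      interpret C: ga_sweedler_map d "{0}" "\<lambda>x y. ga_unit (ga_counit y) * x"
        by unfold_locales
          (simp_all add: eq_mod_0_iff distrib_left distrib_right ga_counit_add ga_unit_add
            ga_counit_mult ga_unit_mult_times)
      show ?thesis
        using C.sweedler_eqI[of "\<lambda>a. a" a] by (simp add: eq_mod_0_iff ga_unit_times_single)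
    qed
    show "tens ga_unit ga_unit [(x * ga_unit l, y). (x, y) \<leftarrow> d a]
        = tens ga_unit ga_unit [(x, y * ga_unit l). (x, y) \<leftarrow> d a]"
      \<comment> \<open>Centrality turns right multiplication by a scalar into the base action, so
        balancing applies to each pair separately.\<close>
      by (unfold tensor_sum_eq_iff sum_list_map_pairs)
        (intro N.sum_list_pair, simp add: N.balanced flip: ga_unit_commute)
    show "ga_comult (a * b)
        = tens ga_unit ga_unit [(x * u, y * v). (x, y) \<leftarrow> d a, (u, v) \<leftarrow> d b]"
      by (rule sym, unfold tens_eq_ga_comult_iff sum_list_map_pairs2)
        (rule sweedler_comult_mult[OF ga_balanced_map_frag_of])
  qed simp_all
qed

section \<open>The twisted antipode\<close>

lemma twisted_S_anti: "ring_anti_automorphism twisted_S"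
  by (rule twisted_S_iff[THEN iffD1, OF refl, THEN conjunct1])

lemma twisted_S_add: "twisted_S (p + q) = twisted_S p + twisted_S q"
  by (rule twisted_S_anti[unfolded ring_anti_automorphism_def, THEN conjunct2, THEN conjunct1,
        rule_format])

lemma twisted_S_unit_mult: "twisted_S (ga_unit c * p) = ga_unit c * twisted_S p"
  using twisted_S_iff[THEN iffD1, OF refl, THEN conjunct2, THEN conjunct1, rule_format,
      where c = c and a = p]
  by (simp only: ga_scale_conv_unit)

text \<open>The sign is the character of Z2 with value -1 at t.\<close>

lemma twisted_S_single:
  "twisted_S (Poly_Mapping.single g c) = Poly_Mapping.single g (if g = 0 then c else - c)"
  by (cases g)
    (simp_all add: twisted_S_def ga_scale_conv_mult gen_t_def mult_single lookup_single
      single_uminus)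

lemma twisted_S_unit: "twisted_S (ga_unit c) = ga_unit c"
  by (simp add: ga_unit_def' twisted_S_single)

lemma twisted_S_twisted_S: "twisted_S (twisted_S p) = p"
proof -
  have "twisted_S (twisted_S p) \<approx>\<^bsub>{0}\<^esub> p"
    by (rule additive_eqI[OF additive_subgroup_0])
      (simp_all add: eq_mod_0_iff twisted_S_add twisted_S_single)
  then show ?thesis by (simp add: eq_mod_0_iff)
qed

text \<open>The signs square to 1, so both antipode axioms can be expressed through
  \<open>twisted_S\<close> alone.\<close>

lemma inv_twisted_S: "inv twisted_S = twisted_S"
  by (rule inv_equality) (rule twisted_S_twisted_S)+

text \<open>On a term c g the inner comultiplication gives two further copies of g up to a scalar.
  One of them meets the remaining leg and collapses to a scalar since g squares to 1.\<close>

theorem hopf_algebroid_twisted_S: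
  "hopf_algebroid (ga_unit :: 'k::field \<Rightarrow> _) ga_unit ga_comult ga_counit twisted_S"
proof -
  interpret left_bialgebroid ga_unit ga_unit "ga_comult :: (bit \<Rightarrow>\<^sub>0 'k) \<Rightarrow> _" ga_counit
    by (rule left_bialgebroid_group_algebra)
  interpret N: ga_balanced_map ga_null
      "\<lambda>x y. frag_of (x, y) :: (bit \<Rightarrow>\<^sub>0 'k) \<times> (bit \<Rightarrow>\<^sub>0 'k) \<Rightarrow>\<^sub>0 int"
    by (rule ga_balanced_map_frag_of)
  \<comment> \<open>The relation t^2 = 1, written additively.\<close>
  have double: "g + g = 0" for g :: bit
    by (cases g) simp_all
  show ?thesis
  proof
    show "ring_anti_automorphism (twisted_S :: (bit \<Rightarrow>\<^sub>0 'k) \<Rightarrow> _)"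
      by (rule twisted_S_anti)
    show "twisted_S (ga_unit l) = ga_unit l" for l :: 'k
      by (rule twisted_S_unit)
    fix d :: "(bit \<Rightarrow>\<^sub>0 'k) \<Rightarrow> ((bit \<Rightarrow>\<^sub>0 'k) \<times> (bit \<Rightarrow>\<^sub>0 'k)) list" and a :: "bit \<Rightarrow>\<^sub>0 'k"
    assume "sweedler ga_unit ga_unit ga_comult d"
    then interpret ga_sweedler d by unfold_locales
    interpret I: ga_sweedler_map d ga_null "\<lambda>u v. frag_of (u, v * x)" for x
      using N.ga_balanced_map_mult[of 1 1 1 x] by (simp add: ga_sweedler_map_iff)
    interpret J: ga_sweedler_map d ga_null "\<lambda>u v. frag_of (u * y, v)" for y
      using N.ga_balanced_map_mult[of 1 y 1 1] by (simp add: ga_sweedler_map_iff)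
    interpret II: ga_sweedler_map d ga_null
        "\<lambda>x y. \<Sum>(u, v)\<leftarrow>d (twisted_S y). frag_of (u, v * x)"
      unfolding ga_sweedler_map_iff
    proof unfold_locales
      fix x y :: "bit \<Rightarrow>\<^sub>0 'k" and c
      \<comment> \<open>Balancing sends the scalar from \<open>x\<close> to the inner first leg;
        there it is absorbed into the decomposition, since \<open>twisted_S\<close> is
        linear.\<close>
      have "(\<Sum>(u, v)\<leftarrow>d (twisted_S y). frag_of (u, v * (ga_unit c * x)))
          \<approx>\<^bsub>ga_null\<^esub> (\<Sum>(u, v)\<leftarrow>d (twisted_S y). frag_of (ga_unit c * u, v * x))"
        by (intro N.sum_list_pair) (simp add: ga_unit_left_commute N.sym[OF N.balanced])
      also have "(\<Sum>(u, v)\<leftarrow>d (twisted_S y). frag_of (ga_unit c * u, v * x))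
          \<approx>\<^bsub>ga_null\<^esub> (\<Sum>(u, v)\<leftarrow>d (twisted_S (ga_unit c * y)). frag_of (u, v * x))"
        unfolding twisted_S_unit_mult by (rule N.sym[OF I.sweedler_scale])
      finally show "(\<Sum>(u, v)\<leftarrow>d (twisted_S y). frag_of (u, v * (ga_unit c * x)))
          \<approx>\<^bsub>ga_null\<^esub> (\<Sum>(u, v)\<leftarrow>d (twisted_S (ga_unit c * y)). frag_of (u, v * x))" .
    qed (simp_all add: distrib_left twisted_S_add I.sweedler_add N.add_right N.sum_list_pair_add)
    interpret JJ: ga_sweedler_map d ga_null
        "\<lambda>x y. \<Sum>(u, v)\<leftarrow>d (twisted_S x). frag_of (u * y, v)"
      unfolding ga_sweedler_map_iff
    proof unfold_locales
      fix x y :: "bit \<Rightarrow>\<^sub>0 'k" and c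
      show "(\<Sum>(u, v)\<leftarrow>d (twisted_S (ga_unit c * x)). frag_of (u * y, v))
          \<approx>\<^bsub>ga_null\<^esub> (\<Sum>(u, v)\<leftarrow>d (twisted_S x). frag_of (u * (ga_unit c * y), v))"
        using J.sweedler_scale[where c = c and p = "twisted_S x" and y = y]
        by (simp add: twisted_S_unit_mult ga_unit_left_commute mult.assoc)
    qed (simp_all add: distrib_left twisted_S_add J.sweedler_add N.add_left N.sum_list_pair_add)
    show "tens ga_unit ga_unit [(u, v * x). (x, y) \<leftarrow> d a, (u, v) \<leftarrow> d (inv twisted_S y)]
        = tens ga_unit ga_unit [(inv twisted_S a, 1)]"
    proof (unfold inv_twisted_S tensor_sum_eq_iff sum_list_map_pairs2, rule II.sweedler_eqI)
      fix g :: bit and c :: 'k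
      \<comment> \<open>Only the sign: the antipode acts on the right leg g, while the coefficient c
        stays on the left.\<close>
      let ?e = "if g = 0 then 1 else - 1 :: 'k"
      have "(\<Sum>(u, v)\<leftarrow>d (Poly_Mapping.single g ?e). frag_of (u, v * Poly_Mapping.single g c))
          \<approx>\<^bsub>ga_null\<^esub> frag_of (Poly_Mapping.single g ?e, ga_unit c * 1)"
        using I.sweedler_single[where g = g and c = ?e and x = "Poly_Mapping.single g c"]
        by (simp add: mult_single double ga_unit_def')
      also have "frag_of (Poly_Mapping.single g ?e, ga_unit c * 1)
          \<approx>\<^bsub>ga_null\<^esub> frag_of (ga_unit c * Poly_Mapping.single g ?e, 1)"
        by (rule N.sym[OF N.balanced])
      finally show "(\<Sum>(u, v)\<leftarrow>d (twisted_S (Poly_Mapping.single g 1)).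
            frag_of (u, v * Poly_Mapping.single g c))
          \<approx>\<^bsub>ga_null\<^esub> (\<Sum>p\<leftarrow>[(twisted_S (Poly_Mapping.single g c), 1)]. frag_of p)"
        by (simp add: twisted_S_single ga_unit_times_single split: if_splits)
    qed (simp add: twisted_S_add N.add_left)
    show "tens ga_unit ga_unit [(u * y, v). (x, y) \<leftarrow> d a, (u, v) \<leftarrow> d (twisted_S x)]
        = tens ga_unit ga_unit [(1, twisted_S a)]"
    proof (unfold tensor_sum_eq_iff sum_list_map_pairs2, rule JJ.sweedler_eqI)
      fix g :: bit and c :: 'k
      \<comment> \<open>Sign and coefficient together: here the antipode acts on the left leg c
        g.\<close>
      let ?e = "if g = 0 then c else - c"
      have "(\<Sum>(u, v)\<leftarrow>d (Poly_Mapping.single g ?e). frag_of (u * Poly_Mapping.single g 1, v))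
          \<approx>\<^bsub>ga_null\<^esub> frag_of (ga_unit ?e * 1, Poly_Mapping.single g 1)"
        using J.sweedler_single[where g = g and c = ?e and y = "Poly_Mapping.single g 1"]
        by (simp add: mult_single double ga_unit_def')
      also have "frag_of (ga_unit ?e * 1, Poly_Mapping.single g 1)
          \<approx>\<^bsub>ga_null\<^esub> frag_of (1, ga_unit ?e * Poly_Mapping.single g 1)"
        by (rule N.balanced)
      finally show "(\<Sum>(u, v)\<leftarrow>d (twisted_S (Poly_Mapping.single g c)).
            frag_of (u * Poly_Mapping.single g 1, v))
          \<approx>\<^bsub>ga_null\<^esub> (\<Sum>p\<leftarrow>[(1, twisted_S (Poly_Mapping.single g c))]. frag_of p)"
        by (simp add: twisted_S_single ga_unit_times_single split: if_splits)
    qed (simp add: twisted_S_add N.add_right)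
  qed
qed

section \<open>Failure of Lu's axiom at t\<close>

lemma not_lu_hopf_algebroid_twisted_S:
  assumes "CHAR('k::field) \<noteq> 2"
  shows "\<not> lu_hopf_algebroid ga_scale ((*) :: 'k \<Rightarrow> 'k \<Rightarrow> 'k)
    (ga_unit :: 'k \<Rightarrow> bit \<Rightarrow>\<^sub>0 'k) ga_unit ga_comult ga_counit twisted_S"
proof
  assume "lu_hopf_algebroid ga_scale ((*) :: 'k \<Rightarrow> 'k \<Rightarrow> 'k)
    (ga_unit :: 'k \<Rightarrow> bit \<Rightarrow>\<^sub>0 'k) ga_unit ga_comult ga_counit twisted_S"
  then interpret lu_hopf_algebroid ga_scale "(*) :: 'k \<Rightarrow> 'k \<Rightarrow> 'k"
    "ga_unit :: 'k \<Rightarrow> bit \<Rightarrow>\<^sub>0 'k" ga_unit ga_comult ga_counit twisted_S .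
  let ?t = "gen_t :: bit \<Rightarrow>\<^sub>0 'k"
  \<comment> \<open>Both tensor products are over k with the same actions, so the canonical
    projection is the identity.\<close>
  have same: "tens_k ga_scale = tens ga_unit (ga_unit :: 'k \<Rightarrow> bit \<Rightarrow>\<^sub>0 'k)"
    by (simp only: ga_scale_eq ga_scale_conv_unit)
  obtain \<zeta> where \<zeta>: "linear_section ga_scale ga_unit (ga_unit :: 'k \<Rightarrow> bit \<Rightarrow>\<^sub>0 'k) \<zeta>"
    and right: "\<zeta> (ga_comult a) = tens_k ga_scale us \<Longrightarrow>
      (\<Sum>(x, y)\<leftarrow>us. x * twisted_S y) = ga_unit (ga_counit a)" for a us
    using S_right by blast
  have comult_t: "ga_comult ?t = tens ga_unit ga_unit [(?t, ?t)]"
    by (simp add: ga_comult_def gen_t_def tensor_sum_def ga_scale_eq ga_scale_conv_unit)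
  \<comment> \<open>The section property speaks of lists, so a list representing the value of
    \<zeta> is chosen first.\<close>
  have "\<zeta> (ga_comult ?t) \<in> range (tens_k ga_scale)"
    using \<zeta> comult_in[of ?t]
    unfolding linear_section_def tensor_product_eq_range_tensor_sum by blast
  then obtain us where us: "\<zeta> (ga_comult ?t) = tens_k ga_scale us" by blast
  then have "tens ga_unit ga_unit us = ga_comult ?t"
    using \<zeta> unfolding linear_section_def comult_t by blast
  \<comment> \<open>Projecting back gives t \<otimes> t, and by \<open>same\<close> this determines
    the value of \<zeta> itself.\<close>
  then have "\<zeta> (ga_comult ?t) = tens_k ga_scale [(?t, ?t)]"
    using us by (simp add: same comult_t)
  from right[OF this] have "?t * twisted_S ?t = 1"
    by (simp add: gen_t_def)
  then have "- (1 :: bit \<Rightarrow>\<^sub>0 'k) = 1"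
    using twisted_S_iff[of "twisted_S :: (bit \<Rightarrow>\<^sub>0 'k) \<Rightarrow> _"] by (simp add: gen_t_squared)
  \<comment> \<open>The coefficient at the group identity brings -1 = 1 down to the field.\<close>
  from arg_cong[OF this, of "\<lambda>p. Poly_Mapping.lookup p 0"] have "(- 1 :: 'k) = 1"
    by (simp add: lookup_one)
  then have "(1 :: 'k) + 1 = 1 + - 1"
    by (simp only:)
  then have "of_nat 2 = (0 :: 'k)"
    by simp
  then have "CHAR('k) dvd 2"
    by (simp only: of_nat_eq_0_iff_char_dvd)
  then have "CHAR('k) = 1 \<or> CHAR('k) = 2"
    using two_is_prime_nat by (auto simp: prime_nat_iff)
  \<comment> \<open>Characteristic 1 would force 1 = 0, which is impossible in a field.\<close>
  then show False
    using assms by simp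
qed

theorem proposition4p10:
  assumes "CHAR('k::field) \<noteq> 2"
  shows "hopf_algebroid (ga_unit :: 'k \<Rightarrow> bit \<Rightarrow>\<^sub>0 'k) ga_unit ga_comult ga_counit twisted_S \<and>
    \<not> lu_hopf_algebroid ga_scale ((*) :: 'k \<Rightarrow> 'k \<Rightarrow> 'k)
        (ga_unit :: 'k \<Rightarrow> bit \<Rightarrow>\<^sub>0 'k) ga_unit ga_comult ga_counit twisted_S"
  using hopf_algebroid_twisted_S not_lu_hopf_algebroid_twisted_S[OF assms] by blast

end
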